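(* For every Lipschitz function $f:S^2\to\mathbb C$ and every $\varepsilon>0$ there exists $p\in\mathcal O(S^2)$ with $$L_{d_{S^2}}(p)\le L_{d_{S^2}}(f)\qquad\text{and}\qquad\|f-p\|_\infty\le\varepsilon\cdot L_{d_{S^2}}(f).$$
   Context: $S^2\subset\mathbb R^3$ is the unit sphere with its usual round (geodesic) metric $d_{S^2}$. For a Lipschitz function $f$ on $S^2$, $L_{d_{S^2}}(f)=\sup\{|f(x)-f(y)|/d_{S^2}(x,y):x,y\in S^2,\ x\ne y\}$ is its Lipschitz constant. $\mathcal O(S^2)$ is the unital $*$-algebra of functions on $S^2$ generated by the three coordinate functions $x_1,x_2,x_3$ of the embedding $S^2\subset\mathbb R^3$, i.e. the restrictions to $S^2$ of complex polynomials in three variables. $\|\cdot\|_\infty$ is the supremum norm. *)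

theory Defs
  imports "HOL-Analysis.Analysis"
begin

abbreviation S2 :: "(real^3) set" where
  "S2 \<equiv> sphere 0 1"

text \<open>
  A function on the sphere is represented by a function on the ambient space of which only
  the values on \<^term>\<open>S2\<close> matter.
\<close>

text \<open>The round metric: the length of the shorter great-circle arc is the angle between unit vectors.\<close>

definition d_S2 :: "real^3 \<Rightarrow> real^3 \<Rightarrow> real" where
  "d_S2 x y = arccos (x \<bullet> y)"

definition lipschitz_S2 :: "(real^3 \<Rightarrow> complex) \<Rightarrow> bool" where
  "lipschitz_S2 f \<longleftrightarrow> (\<exists>C. \<forall>x\<in>S2. \<forall>y\<in>S2. cmod (f x - f y) \<le> C * d_S2 x y)"

text \<open>
  Both suprema are taken in \<^typ>\<open>ennreal\<close>, so that they are the true suprema even when no bound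
  is known beforehand; a real-valued supremum of an unbounded set would be unspecified.
\<close>

definition Lip_S2 :: "(real^3 \<Rightarrow> complex) \<Rightarrow> ennreal" where
  "Lip_S2 f = Sup {ennreal (cmod (f x - f y) / d_S2 x y) | x y. x \<in> S2 \<and> y \<in> S2 \<and> x \<noteq> y}"

definition supnorm_S2 :: "(real^3 \<Rightarrow> complex) \<Rightarrow> ennreal" where
  "supnorm_S2 f = (SUP x\<in>S2. ennreal (cmod (f x)))"

text \<open>
  The unital *-algebra generated by the coordinate functions, with involution given by pointwise
  complex conjugation. The rule \<open>restrict\<close> identifies functions that agree on the sphere.
\<close>

inductive_set O_S2 :: "(real^3 \<Rightarrow> complex) set" where
  coord: "(\<lambda>x. complex_of_real (x $ i)) \<in> O_S2"
| const: "(\<lambda>x. c) \<in> O_S2"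
| add: "p \<in> O_S2 \<Longrightarrow> q \<in> O_S2 \<Longrightarrow> (\<lambda>x. p x + q x) \<in> O_S2"
| mult: "p \<in> O_S2 \<Longrightarrow> q \<in> O_S2 \<Longrightarrow> (\<lambda>x. p x * q x) \<in> O_S2"
| star: "p \<in> O_S2 \<Longrightarrow> (\<lambda>x. cnj (p x)) \<in> O_S2"
| restrict: "p \<in> O_S2 \<Longrightarrow> (\<And>x. x \<in> S2 \<Longrightarrow> q x = p x) \<Longrightarrow> q \<in> O_S2"

lemma O_S2_sum: "(\<And>i. i \<in> A \<Longrightarrow> g i \<in> O_S2) \<Longrightarrow> (\<lambda>x. \<Sum>i\<in>A. g i x) \<in> O_S2"
  by (induction A rule: infinite_finite_induct) (simp_all add: O_S2.const O_S2.add)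

lemma real_polynomial_function_O_S2:
  "real_polynomial_function g \<Longrightarrow> (\<lambda>x. complex_of_real (g x)) \<in> O_S2"
proof (induction rule: real_polynomial_function.induct)
  case (linear f)
  have expand: "f x = (\<Sum>i\<in>UNIV. f (axis i 1) * x $ i)" for x
  proof -
    have "f x = f (\<Sum>i\<in>UNIV. x $ i *\<^sub>R axis i 1)"
      by (simp only: basis_expansion[of x, unfolded scalar_mult_eq_scaleR])
    then show ?thesis
      using linear by (simp add: linear_sum linear_scale bounded_linear.linear mult.commute)
  qed
  have "(\<lambda>x. complex_of_real (f x)) =
      (\<lambda>x. \<Sum>i\<in>UNIV. complex_of_real (f (axis i 1)) * complex_of_real (x $ i))"
    by (rule ext, subst expand) simp
  then show ?case
    by (simp only:) (intro O_S2_sum O_S2.mult O_S2.const O_S2.coord)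
qed (simp_all add: O_S2.const O_S2.add O_S2.mult)

lemma polynomial_function_cnj:
  assumes "polynomial_function (p :: real^3 \<Rightarrow> complex)"
  shows "polynomial_function (\<lambda>x. cnj (p x))"
  using polynomial_function_compose[OF assms polynomial_function_bounded_linear[OF bounded_linear_cnj]]
  by (simp add: o_def)

lemma polynomial_function_times:
  assumes "polynomial_function (p :: real^3 \<Rightarrow> complex)" "polynomial_function q"
  shows "polynomial_function (\<lambda>x. p x * q x)"
proof -
  have re: "real_polynomial_function (\<lambda>x. Re (r x))" "real_polynomial_function (\<lambda>x. Im (r x))"
    if "polynomial_function r" for r :: "real^3 \<Rightarrow> complex"
    using that bounded_linear_Re bounded_linear_Im
    unfolding polynomial_function_def by (auto simp: o_def)
  have "real_polynomial_function (\<lambda>x. Re (p x) * Re (q x) - Im (p x) * Im (q x))"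
    by (intro real_polynomial_function_diff real_polynomial_function.intros(4) re assms)
  moreover have "real_polynomial_function (\<lambda>x. Re (p x) * Im (q x) + Im (p x) * Re (q x))"
    by (intro real_polynomial_function.intros(3) real_polynomial_function.intros(4) re assms)
  ultimately show ?thesis
    by (simp add: polynomial_function_iff_Basis_inner Basis_complex_def inner_complex_def)
qed

text \<open>Equivalently, restrictions to the sphere of complex polynomials in three variables.\<close>

lemma O_S2_iff_polynomial_function:
  "p \<in> O_S2 \<longleftrightarrow> (\<exists>P. polynomial_function P \<and> (\<forall>x\<in>S2. p x = P x))"
proof
  assume "p \<in> O_S2"
  then show "\<exists>P. polynomial_function P \<and> (\<forall>x\<in>S2. p x = P x)"
  proof induction
    case (coord i)
    have "polynomial_function (\<lambda>x::real^3. complex_of_real (x $ i))"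
      by (intro polynomial_function_bounded_linear bounded_linear_compose[OF bounded_linear_of_real]
          bounded_linear_vec_nth)
    then show ?case by blast
  next
    case (const c)
    show ?case by (rule exI[of _ "\<lambda>x. c"]) simp
  next
    case (add p q)
    then obtain P Q where "polynomial_function P" "\<forall>x\<in>S2. p x = P x"
      "polynomial_function Q" "\<forall>x\<in>S2. q x = Q x" by blast
    then show ?case by (intro exI[of _ "\<lambda>x. P x + Q x"]) (simp add: polynomial_function_add)
  next
    case (mult p q)
    then obtain P Q where "polynomial_function P" "\<forall>x\<in>S2. p x = P x"
      "polynomial_function Q" "\<forall>x\<in>S2. q x = Q x" by blast
    then show ?case
      by (intro exI[of _ "\<lambda>x. P x * Q x"]) (simp add: polynomial_function_times)
  next
    case (star p)
    then obtain P where "polynomial_function P" "\<forall>x\<in>S2. p x = P x" by blast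
    then show ?case
      by (intro exI[of _ "\<lambda>x. cnj (P x)"]) (simp add: polynomial_function_cnj)
  next
    case (restrict p q)
    then show ?case by auto
  qed
next
  assume "\<exists>P. polynomial_function P \<and> (\<forall>x\<in>S2. p x = P x)"
  then obtain P where P: "polynomial_function P" "\<forall>x\<in>S2. p x = P x" by blast
  have "real_polynomial_function (\<lambda>x. Re (P x))" "real_polynomial_function (\<lambda>x. Im (P x))"
    using P(1) bounded_linear_Re bounded_linear_Im
    unfolding polynomial_function_def by (auto simp: o_def)
  then have "(\<lambda>x. complex_of_real (Re (P x)) + \<i> * complex_of_real (Im (P x))) \<in> O_S2"
    by (intro O_S2.add O_S2.mult O_S2.const real_polynomial_function_O_S2)
  then show "p \<in> O_S2"
    by (rule O_S2.restrict) (simp add: P(2) complex_eq[symmetric])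
qed

end

theory Submission
  imports Defs
begin

text \<open>
  The approximant is the convolution of \<open>f\<close> with a polynomial zonal probability kernel,
  \[ p(x) = \frac1c \int_{S^2} (1 + x \cdot u)^n f(u)\, d\sigma(u), \]
  where \<open>\<sigma>\<close> is a rotation-invariant measure on the sphere and \<open>c\<close> is the total mass of the kernel,
  which by invariance is the same for every \<open>x\<close>. Expanding the power shows that \<open>p\<close> is a
  polynomial in the coordinates of \<open>x\<close> (\<open>integral_kernel_in_O_S2\<close>).

  The Lipschitz constant does not increase at all, because convolution commutes with
  rotations: if \<open>R\<close> is orthogonal with \<open>R x = x'\<close>, then substituting \<open>R u\<close> for \<open>u\<close> gives
  \[ p(x') - p(x) = \frac1c \int (1 + x \cdot u)^n (f(R u) - f(u))\, d\sigma(u), \]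
  which in absolute value is at most \<open>L\<close> times the largest distance from \<open>u\<close> to \<open>R u\<close>. When \<open>R\<close> is the
  rotation along the great circle through \<open>x\<close> and \<open>x'\<close>, no point moves farther than \<open>x\<close> itself
  does (\<open>rotation_between_unit_vectors\<close>), so the bound is \<open>L d(x, x')\<close>.

  For the uniform estimate, \<open>\<bar>f(x) - p(x)\<bar>\<close> is at most \<open>L\<close> times the average of \<open>d(x, u)\<close> under the
  kernel. As \<open>n\<close> grows the kernel concentrates at \<open>u = x\<close>, and by invariance equally fast
  for every \<open>x\<close> (\<open>kernel_concentrates\<close>), so this average drops below \<open>\<epsilon>\<close>.
\<close>

section \<open>Rotating one point of the sphere to another\<close>

text \<open>
  Cauchy-Schwarz for the components of \<open>y\<close> and \<open>z\<close> orthogonal to \<open>x\<close>; it says that the Gram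
  determinant of three unit vectors is nonnegative.
\<close>

lemma gram_determinant_nonneg:
  fixes x y z :: "'a::real_inner"
  assumes "norm x = 1" "norm y = 1" "norm z = 1"
  shows "(x \<bullet> z)\<^sup>2 + (y \<bullet> z)\<^sup>2 - 2 * (x \<bullet> z) * (y \<bullet> z) * (x \<bullet> y) \<le> 1 - (x \<bullet> y)\<^sup>2"
proof -
  have one: "x \<bullet> x = 1" "y \<bullet> y = 1" "z \<bullet> z = 1"
    using assms by (simp_all add: norm_eq_1)
  define p where "p = y - (x \<bullet> y) *\<^sub>R x"
  define q where "q = z - (x \<bullet> z) *\<^sub>R x"
  have "(p \<bullet> q)\<^sup>2 \<le> (p \<bullet> p) * (q \<bullet> q)"
    by (rule Cauchy_Schwarz_ineq)
  moreover have "p \<bullet> q = y \<bullet> z - (x \<bullet> y) * (x \<bullet> z)" "p \<bullet> p = 1 - (x \<bullet> y)\<^sup>2" "q \<bullet> q = 1 - (x \<bullet> z)\<^sup>2"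
    by (simp_all add: p_def q_def one inner_diff inner_commute power2_eq_square algebra_simps)
  ultimately show ?thesis
    by (simp add: power2_eq_square algebra_simps)
qed

text \<open>The rotation by \<open>\<pi>\<close> about the axis spanned by \<open>w\<close>.\<close>

definition half_turn :: "'a::real_inner \<Rightarrow> 'a \<Rightarrow> 'a" where
  "half_turn w y = (2 * (w \<bullet> y) / (w \<bullet> w)) *\<^sub>R w - y"

lemma orthogonal_transformation_half_turn: "orthogonal_transformation (half_turn w)"
  unfolding orthogonal_transformation_def
proof (intro conjI allI)
  show "linear (half_turn w)"
    by (rule linearI)
      (simp_all add: half_turn_def inner_add scaleR_add_left scaleR_diff_right add_divide_distrib distrib_left)
  show "half_turn w u \<bullet> half_turn w v = u \<bullet> v" for u v
    by (cases "w = 0") (simp_all add: half_turn_def inner_diff inner_commute)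
qed

text \<open>
  The half turn about \<open>x\<close> followed by the one about the bisector \<open>x + x'\<close> is the rotation in the
  plane of \<open>x\<close> and \<open>x'\<close> by the angle between them. Only the component of \<open>y\<close> in that plane turns,
  which is why \<open>y\<close> moves by at most that angle; in coordinates the claim amounts to the Gram
  determinant of \<open>x\<close>, \<open>x'\<close>, \<open>y\<close> being nonnegative. Antipodal points have no bisector, but for
  them every displacement is allowed, so the antipodal map serves.
\<close>

lemma rotation_between_unit_vectors:
  fixes x x' :: "'a::euclidean_space"
  assumes "norm x = 1" "norm x' = 1"
  obtains R where "orthogonal_transformation R" "R x = x'"
    "\<And>y. norm y = 1 \<Longrightarrow> x \<bullet> x' \<le> y \<bullet> R y"
proof (cases "x \<bullet> x' = -1")
  case True
  have "norm (x + x') ^ 2 = 0"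
    using True assms by (simp add: power2_norm_eq_inner inner_add inner_commute norm_eq_1)
  then have "x' = - x"
    by (simp add: eq_neg_iff_add_eq_0 add.commute)
  moreover have "orthogonal_transformation (\<lambda>y::'a. - y)"
    by (simp add: orthogonal_transformation_neg)
  ultimately show ?thesis
    using assms by (intro that[of "\<lambda>y. - y"]) (auto simp: norm_eq_1)
next
  case False
  define c where "c = x \<bullet> x'"
  have one: "x \<bullet> x = 1" "x' \<bullet> x' = 1"
    using assms by (simp_all add: norm_eq_1)
  have "\<bar>c\<bar> \<le> 1"
    using Cauchy_Schwarz_ineq2[of x x'] assms by (simp add: c_def)
  then have c: "1 + c > 0"
    using False by (simp add: c_def)
  have ww: "(x + x') \<bullet> (x + x') = 2 * (1 + c)"
    by (simp add: inner_add one c_def inner_commute)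
  define R where "R = half_turn (x + x') \<circ> half_turn x"
  have R: "R y = y - (((x + x') \<bullet> y) / (1 + c)) *\<^sub>R (x + x') + (2 * (x \<bullet> y)) *\<^sub>R x'" for y
  proof -
    have "(x + x') \<bullet> half_turn x y = 2 * (x \<bullet> y) * (1 + c) - (x + x') \<bullet> y"
      by (simp add: half_turn_def one inner_add inner_diff inner_commute c_def algebra_simps)
    then have "((x + x') \<bullet> half_turn x y) / (1 + c) = 2 * (x \<bullet> y) - ((x + x') \<bullet> y) / (1 + c)"
      using c by (simp add: diff_divide_distrib)
    then have "R y = (2 * (x \<bullet> y) - ((x + x') \<bullet> y) / (1 + c)) *\<^sub>R (x + x') - half_turn x y"
      unfolding R_def o_def half_turn_def[of "x + x'"] ww mult_divide_mult_cancel_left[OF zero_neq_numeral[symmetric]] by simp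
    then show ?thesis
      by (simp add: half_turn_def one scaleR_diff_left scaleR_add_right)
  qed
  have "orthogonal_transformation R"
    unfolding R_def by (intro orthogonal_transformation_compose orthogonal_transformation_half_turn)
  moreover have "R x = x'"
    using c by (simp add: R inner_add one inner_commute c_def[symmetric] scaleR_2)
  moreover have "c \<le> y \<bullet> R y" if "norm y = 1" for y
  proof -
    define a where "a = x \<bullet> y"
    define b where "b = x' \<bullet> y"
    have "y \<bullet> R y = 1 - (a + b)\<^sup>2 / (1 + c) + 2 * a * b"
      using that by (simp add: R a_def b_def inner_add inner_diff norm_eq_1 inner_commute power2_eq_square)
    moreover have "a\<^sup>2 + b\<^sup>2 - 2 * a * b * c \<le> 1 - c\<^sup>2"
      using gram_determinant_nonneg[OF assms that] by (simp add: a_def b_def c_def)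
    then have "(a + b)\<^sup>2 \<le> (1 - c + 2 * a * b) * (1 + c)"
      by (simp add: power2_eq_square algebra_simps)
    then have "(a + b)\<^sup>2 / (1 + c) \<le> 1 - c + 2 * a * b"
      using c by (simp add: pos_divide_le_eq)
    ultimately show ?thesis by simp
  qed
  ultimately show ?thesis
    by (intro that[of R]) (auto simp: c_def)
qed

section \<open>The geodesic distance\<close>

lemma inner_S2_bounds: "x \<in> S2 \<Longrightarrow> y \<in> S2 \<Longrightarrow> - 1 \<le> x \<bullet> y \<and> x \<bullet> y \<le> 1"
  using Cauchy_Schwarz_ineq2[of x y] by auto

lemma d_S2_bounds:
  assumes "x \<in> S2" "y \<in> S2"
  shows "0 \<le> d_S2 x y" "d_S2 x y \<le> pi"
  using arccos_bounded inner_S2_bounds[OF assms] by (auto simp: d_S2_def)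

lemma d_S2_refl: "x \<in> S2 \<Longrightarrow> d_S2 x x = 0"
  by (simp add: d_S2_def norm_eq_1)

lemma d_S2_pos:
  assumes "x \<in> S2" "y \<in> S2" "x \<noteq> y"
  shows "0 < d_S2 x y"
proof -
  have "x \<bullet> y \<noteq> 1"
  proof
    assume "x \<bullet> y = 1"
    then have "norm (x - y) ^ 2 = 0"
      using assms by (simp add: power2_norm_eq_inner inner_diff inner_commute norm_eq_1)
    then show False using assms by simp
  qed
  then have "arccos 1 < arccos (x \<bullet> y)"
    using inner_S2_bounds[OF assms(1,2)] by (intro arccos_less_arccos) auto
  then show ?thesis by (simp add: d_S2_def)
qed

lemma Lip_S2_le:
  assumes "\<And>x y. x \<in> S2 \<Longrightarrow> y \<in> S2 \<Longrightarrow> cmod (f x - f y) \<le> L * d_S2 x y"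
  shows "Lip_S2 f \<le> ennreal L"
  unfolding Lip_S2_def
proof (rule Sup_least, clarify)
  fix x y :: "real^3"
  assume "x \<in> S2" "y \<in> S2" "x \<noteq> y"
  then show "ennreal (cmod (f x - f y) / d_S2 x y) \<le> ennreal L"
    using assms[of x y] d_S2_pos[of x y] by (intro ennreal_leI) (simp add: divide_le_eq)
qed

text \<open>Rewrites the extended-real supremum as an honest best Lipschitz constant.\<close>

lemma lipschitz_S2_attains_Lip:
  assumes "lipschitz_S2 f"
  obtains L where "0 \<le> L" "Lip_S2 f = ennreal L"
    "\<And>x y. x \<in> S2 \<Longrightarrow> y \<in> S2 \<Longrightarrow> cmod (f x - f y) \<le> L * d_S2 x y"
proof -
  obtain C where "\<And>x y. x \<in> S2 \<Longrightarrow> y \<in> S2 \<Longrightarrow> cmod (f x - f y) \<le> C * d_S2 x y"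
    using assms unfolding lipschitz_S2_def by blast
  then have "Lip_S2 f \<le> ennreal C" by (rule Lip_S2_le)
  then have "Lip_S2 f < top"
    using ennreal_less_top le_less_trans by blast
  then obtain L where L: "0 \<le> L" "Lip_S2 f = ennreal L"
    by (cases "Lip_S2 f") auto
  have "cmod (f x - f y) \<le> L * d_S2 x y" if xy: "x \<in> S2" "y \<in> S2" for x y
  proof (cases "x = y")
    case False
    have "ennreal (cmod (f x - f y) / d_S2 x y) \<le> ennreal L"
      unfolding L(2)[symmetric] Lip_S2_def using xy False by (intro Sup_upper) blast
    then show ?thesis
      using L(1) d_S2_pos[OF xy False] by (simp add: divide_le_eq)
  qed (use xy in \<open>simp add: d_S2_refl\<close>)
  with L show ?thesis using that by blast
qed

lemma lipschitz_S2_imp_continuous: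
  assumes "\<And>x y. x \<in> S2 \<Longrightarrow> y \<in> S2 \<Longrightarrow> cmod (f x - f y) \<le> L * d_S2 x y"
  shows "continuous_on S2 f"
  unfolding continuous_on_def
proof
  fix x :: "real^3"
  assume x: "x \<in> S2"
  have "continuous_on S2 (d_S2 x)"
    unfolding d_S2_def using inner_S2_bounds[OF x] by (intro continuous_intros) auto
  then have "((\<lambda>y. L * d_S2 x y) \<longlongrightarrow> L * d_S2 x x) (at x within S2)"
    using x by (intro tendsto_mult tendsto_const) (simp add: continuous_on_def)
  then have "((\<lambda>y. L * d_S2 x y) \<longlongrightarrow> 0) (at x within S2)"
    using x by (simp add: d_S2_refl)
  then have "((\<lambda>y. f y - f x) \<longlongrightarrow> 0) (at x within S2)"
    by (rule Lim_null_comparison[rotated])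
      (use assms[OF x] in \<open>auto simp: eventually_at_filter norm_minus_commute\<close>)
  then show "(f \<longlongrightarrow> f x) (at x within S2)"
    by (simp add: LIM_zero_iff)
qed

section \<open>The rotation-invariant measure on the sphere\<close>

text \<open>
  Radial projection of the uniform distribution on the unit ball; up to normalisation this is the
  surface measure. The centre is removed because \<open>sgn 0 = 0\<close> is off the sphere. In this form
  the invariance under orthogonal maps is inherited from Lebesgue measure.
\<close>

definition \<sigma> :: "(real^3) measure" where
  "\<sigma> = distr (uniform_measure lborel (ball 0 1 - {0})) borel sgn"

lemma sets_\<sigma> [measurable_cong, simp]: "sets \<sigma> = sets borel"
  by (simp add: \<sigma>_def)

lemma space_\<sigma> [simp]: "space \<sigma> = UNIV"
  by (simp add: \<sigma>_def)

lemma emeasure_lborel_open_pos: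
  fixes A :: "'a::euclidean_space set"
  assumes "open A" "A \<noteq> {}"
  shows "emeasure lborel A \<noteq> 0"
  using open_not_negligible[OF assms] assms(1)
  by (auto simp: negligible_iff_null_sets null_sets_def)

lemma punctured_ball:
  "emeasure lborel (ball 0 1 - {0 :: real^3}) \<noteq> 0" "emeasure lborel (ball 0 1 - {0 :: real^3}) < \<infinity>"
proof -
  have "(1/2) *\<^sub>R axis 1 1 \<in> ball 0 1 - {0 :: real^3}"
    by (simp add: norm_axis_1)
  then have "ball 0 1 - {0 :: real^3} \<noteq> {}"
    by blast
  then show "emeasure lborel (ball 0 1 - {0 :: real^3}) \<noteq> 0"
    by (intro emeasure_lborel_open_pos) auto
  have "emeasure lborel (ball 0 1 - {0 :: real^3}) \<le> emeasure lborel (ball 0 1 :: (real^3) set)"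
    by (intro emeasure_mono) auto
  also have "\<dots> < \<infinity>"
    by (intro emeasure_bounded_finite) auto
  finally show "emeasure lborel (ball 0 1 - {0 :: real^3}) < \<infinity>" .
qed

interpretation \<sigma>: finite_measure \<sigma>
proof
  show "emeasure \<sigma> (space \<sigma>) \<noteq> \<infinity>"
    using punctured_ball by (simp add: \<sigma>_def emeasure_distr)
qed

lemma emeasure_\<sigma>:
  assumes [measurable]: "A \<in> sets borel"
  shows "emeasure \<sigma> A =
    emeasure lborel ((ball 0 1 - {0}) \<inter> sgn -` A) / emeasure lborel (ball 0 1 - {0 :: real^3})"
proof -
  have "sgn -` A \<in> sets borel"
    using measurable_sets[OF borel_measurable_sgn assms] by simp
  then show ?thesis
    by (simp add: \<sigma>_def emeasure_distr)
qed

lemma AE_\<sigma>_S2: "AE u in \<sigma>. u \<in> S2"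
proof -
  have "AE y in uniform_measure lborel (ball 0 1 - {0 :: real^3}). sgn y \<in> S2"
    by (rule AE_uniform_measureI) (auto simp: norm_sgn)
  then show ?thesis
    unfolding \<sigma>_def by (subst AE_distr_iff) auto
qed

lemma orthogonal_transformation_measurable:
  fixes R :: "'a::euclidean_space \<Rightarrow> 'a"
  assumes "orthogonal_transformation R"
  shows "R \<in> borel_measurable borel"
  using assms by (intro borel_measurable_continuous_onI linear_continuous_on)
    (simp add: orthogonal_transformation_linear linear_conv_bounded_linear[symmetric])

lemma distr_\<sigma>_rotation:
  assumes R: "orthogonal_transformation R"
  shows "distr \<sigma> borel R = \<sigma>"
proof (rule measure_eqI)
  fix A :: "(real^3) set" assume "A \<in> sets (distr \<sigma> borel R)"
  then have A [measurable]: "A \<in> sets borel" by simp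
  let ?B = "ball 0 1 - {0 :: real^3}"
  have lin: "linear R" using R by (simp add: orthogonal_transformation_linear)
  have [measurable]: "R \<in> borel_measurable borel"
    using R by (rule orthogonal_transformation_measurable)
  have RA: "R -` A \<in> sets borel"
    using measurable_sets[of R borel borel A] by simp
  have meas: "?B \<inter> sgn -` C \<in> sets borel" if "C \<in> sets borel" for C
    using measurable_sets[OF borel_measurable_sgn that] by simp
  have sgnR: "sgn (R y) = R (sgn y)" for y
    using R lin by (simp add: sgn_div_norm orthogonal_transformation_norm linear_scale)
  have R0: "R y = 0 \<longleftrightarrow> y = 0" for y
    using orthogonal_transformation_norm[OF R, of y] by (metis norm_eq_zero)
  have image: "R ` (?B \<inter> sgn -` (R -` A)) = ?B \<inter> sgn -` A"
  proof (intro subset_antisym subsetI)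
    fix y assume y: "y \<in> ?B \<inter> sgn -` A"
    obtain z where "y = R z" using orthogonal_transformation_surj[OF R] by blast
    then show "y \<in> R ` (?B \<inter> sgn -` (R -` A))"
      using y R lin by (auto simp: orthogonal_transformation_norm sgnR R0)
  qed (use R in \<open>auto simp: orthogonal_transformation_norm sgnR R0\<close>)
  have fin: "?B \<inter> sgn -` C \<in> lmeasurable" if "C \<in> sets borel" for C
    by (rule bounded_set_imp_lmeasurable)
      (use meas[OF that] in \<open>auto intro: bounded_subset[OF bounded_ball]\<close>)
  have "emeasure lebesgue (R ` (?B \<inter> sgn -` (R -` A))) = emeasure lebesgue (?B \<inter> sgn -` (R -` A))"
    using measurable_orthogonal_image[OF R fin[OF RA]] measure_orthogonal_image[OF R fin[OF RA]] fin[OF RA]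
    by (simp add: emeasure_eq_measure2)
  then have "emeasure lborel (?B \<inter> sgn -` A) = emeasure lborel (?B \<inter> sgn -` (R -` A))"
    unfolding image using meas[OF A] meas[OF RA] by simp
  then show "emeasure (distr \<sigma> borel R) A = emeasure \<sigma> A"
    using RA by (simp add: emeasure_distr emeasure_\<sigma>)
qed simp

lemma integral_\<sigma>_rotation:
  fixes h :: "real^3 \<Rightarrow> 'b::{banach,second_countable_topology}"
  assumes R: "orthogonal_transformation R" and "h \<in> borel_measurable borel"
  shows "(\<integral>u. h (R u) \<partial>\<sigma>) = (\<integral>u. h u \<partial>\<sigma>)"
proof -
  have "R \<in> measurable \<sigma> borel"
    using orthogonal_transformation_measurable[OF R] by (simp cong: measurable_cong_sets)
  then show ?thesis
    using integral_distr[of R \<sigma> borel h] assms by (simp add: distr_\<sigma>_rotation)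
qed

text \<open>The part of the open ball over a cap contains a nonempty open set, namely a truncated cone around \<open>x\<close>.\<close>

lemma measure_\<sigma>_cap_pos:
  assumes x: "x \<in> S2" and "t < 1"
  shows "0 < measure \<sigma> {u. t \<le> x \<bullet> u}"
proof -
  let ?U = "(ball 0 1 - {0}) \<inter> {y. t * norm y < x \<bullet> y}"
  have "open ?U"
    by (intro open_Int open_Diff open_ball open_Collect_less continuous_intros)
  moreover have "(1/2) *\<^sub>R x \<in> ?U"
    using x \<open>t < 1\<close> by (auto simp flip: power2_norm_eq_inner)
  then have "?U \<noteq> {}" by blast
  ultimately have "emeasure lborel ?U \<noteq> 0"
    by (rule emeasure_lborel_open_pos)
  moreover have C: "{u. t \<le> x \<bullet> u} \<in> sets borel" by measurable
  have "?U \<subseteq> (ball 0 1 - {0}) \<inter> sgn -` {u. t \<le> x \<bullet> u}"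
    by (auto simp: sgn_div_norm field_simps)
  then have "emeasure lborel ?U \<le> emeasure lborel ((ball 0 1 - {0}) \<inter> sgn -` {u. t \<le> x \<bullet> u})"
    using measurable_sets[OF borel_measurable_sgn C] by (intro emeasure_mono) auto
  ultimately have "emeasure \<sigma> {u. t \<le> x \<bullet> u} \<noteq> 0"
    using punctured_ball by (auto simp: emeasure_\<sigma>[OF C] ennreal_divide_eq_0_iff)
  then show ?thesis
    by (simp add: \<sigma>.emeasure_eq_measure zero_less_measure_iff)
qed

lemma integrable_\<sigma>:
  fixes h :: "real^3 \<Rightarrow> 'b::{banach,second_countable_topology}"
  assumes "h \<in> borel_measurable borel" "\<And>u. u \<in> S2 \<Longrightarrow> norm (h u) \<le> B"
  shows "integrable \<sigma> h"
  using assms AE_\<sigma>_S2 by (intro \<sigma>.integrable_const_bound[where B = B]) (auto elim: eventually_mono)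


section \<open>Polynomial zonal kernels\<close>

text \<open>
  For \<open>u\<close> on the sphere this is a nonnegative function of the distance from \<open>x\<close> to \<open>u\<close>, largest at
  \<open>u = x\<close>, and a polynomial in \<open>x\<close>. It is left unnormalised; the average of a function under the
  kernel is its integral divided by \<open>mass\<close>, defined below.
\<close>

definition zonal_kernel :: "nat \<Rightarrow> real^3 \<Rightarrow> real^3 \<Rightarrow> real" where
  "zonal_kernel n x u = (1 + x \<bullet> u) ^ n"

lemma kernel_measurable [measurable]: "zonal_kernel n x \<in> borel_measurable borel"
  unfolding zonal_kernel_def by measurable

lemma kernel_nonneg: "x \<in> S2 \<Longrightarrow> u \<in> S2 \<Longrightarrow> 0 \<le> zonal_kernel n x u"
  using inner_S2_bounds[of x u] by (simp add: zonal_kernel_def)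

lemma integrable_kernel:
  fixes h :: "real^3 \<Rightarrow> 'b::{banach,second_countable_topology}"
  assumes [measurable]: "h \<in> borel_measurable borel"
    and bound: "\<And>u. u \<in> S2 \<Longrightarrow> norm (h u) \<le> B"
  shows "integrable \<sigma> (\<lambda>u. zonal_kernel n x u *\<^sub>R h u)"
proof (rule integrable_\<sigma>)
  show "(\<lambda>u. zonal_kernel n x u *\<^sub>R h u) \<in> borel_measurable borel" by measurable
  fix u :: "real^3" assume u: "u \<in> S2"
  have "\<bar>1 + x \<bullet> u\<bar> \<le> 1 + norm x"
    using Cauchy_Schwarz_ineq2[of x u] u by simp
  then have "\<bar>zonal_kernel n x u\<bar> \<le> (1 + norm x) ^ n"
    unfolding zonal_kernel_def power_abs by (intro power_mono) auto
  then show "norm (zonal_kernel n x u *\<^sub>R h u) \<le> (1 + norm x) ^ n * B"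
    using bound[OF u] by (simp add: mult_mono)
qed

lemma integral_kernel_rotation:
  fixes h :: "real^3 \<Rightarrow> 'b::{banach,second_countable_topology}"
  assumes R: "orthogonal_transformation R" and [measurable]: "h \<in> borel_measurable borel"
  shows "(\<integral>u. zonal_kernel n (R x) u *\<^sub>R h u \<partial>\<sigma>) = (\<integral>u. zonal_kernel n x u *\<^sub>R h (R u) \<partial>\<sigma>)"
proof -
  have "(\<integral>u. zonal_kernel n (R x) u *\<^sub>R h u \<partial>\<sigma>) = (\<integral>u. zonal_kernel n (R x) (R u) *\<^sub>R h (R u) \<partial>\<sigma>)"
    by (rule integral_\<sigma>_rotation[OF R, symmetric]) measurable
  moreover have "zonal_kernel n (R x) (R u) = zonal_kernel n x u" for u
    using R by (simp add: zonal_kernel_def orthogonal_transformation_def)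
  ultimately show ?thesis by simp
qed

text \<open>
  Splitting off one factor \<open>1 + x \<bullet> u\<close> of the kernel turns the integral for \<open>h\<close> into a combination, with
  coefficients 1 and \<open>x $ i\<close>, of integrals of lower degree for \<open>h\<close> and for \<open>u $ i\<close> times \<open>h u\<close>.
  The induction therefore has to run over all bounded \<open>h\<close> at once.
\<close>

lemma integral_kernel_in_O_S2:
  assumes "h \<in> borel_measurable borel" "\<And>u. u \<in> S2 \<Longrightarrow> cmod (h u) \<le> B"
  shows "(\<lambda>x. \<integral>u. zonal_kernel n x u *\<^sub>R h u \<partial>\<sigma>) \<in> O_S2"
  using assms
proof (induction n arbitrary: h)
  case 0
  show ?case by (simp add: zonal_kernel_def O_S2.const)
next
  case (Suc n)
  note [measurable] = Suc.prems(1)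
  let ?h = "\<lambda>i u. complex_of_real (u $ i) * h u"
  have h [measurable]: "?h i \<in> borel_measurable borel" for i
    by measurable
  have B: "cmod (?h i u) \<le> B" if "u \<in> S2" for i u
  proof -
    have "\<bar>u $ i\<bar> \<le> 1" using component_le_norm_cart[of u i] that by simp
    then have "\<bar>u $ i\<bar> * cmod (h u) \<le> 1 * B"
      using Suc.prems(2)[OF that] by (intro mult_mono) auto
    then show ?thesis by (simp add: norm_mult)
  qed
  have "(\<integral>u. zonal_kernel (Suc n) x u *\<^sub>R h u \<partial>\<sigma>) = (\<integral>u. zonal_kernel n x u *\<^sub>R h u \<partial>\<sigma>)
    + (\<Sum>i\<in>UNIV. complex_of_real (x $ i) * (\<integral>u. zonal_kernel n x u *\<^sub>R ?h i u \<partial>\<sigma>))" for x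
  proof -
    have "zonal_kernel (Suc n) x u *\<^sub>R h u = zonal_kernel n x u *\<^sub>R h u
      + (\<Sum>i\<in>UNIV. complex_of_real (x $ i) * (zonal_kernel n x u *\<^sub>R ?h i u))" for u
    proof -
      have "complex_of_real (x \<bullet> u) = (\<Sum>i\<in>UNIV. complex_of_real (x $ i) * complex_of_real (u $ i))"
        by (simp add: inner_vec_def)
      moreover have "zonal_kernel (Suc n) x u *\<^sub>R h u
          = zonal_kernel n x u *\<^sub>R h u + complex_of_real (x \<bullet> u) * (zonal_kernel n x u *\<^sub>R h u)"
        by (simp add: zonal_kernel_def scaleR_conv_of_real algebra_simps)
      ultimately show ?thesis
        by (simp add: sum_distrib_left sum_distrib_right scaleR_conv_of_real ac_simps)
    qed
    moreover have "integrable \<sigma> (\<lambda>u. zonal_kernel n x u *\<^sub>R h u)"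
      by (rule integrable_kernel[OF Suc.prems])
    moreover have "integrable \<sigma> (\<lambda>u. zonal_kernel n x u *\<^sub>R ?h i u)" for i
      by (rule integrable_kernel[OF h B])
    ultimately show ?thesis
      by (simp only: Bochner_Integration.integral_add Bochner_Integration.integral_sum
        Bochner_Integration.integrable_sum integrable_mult_right integral_mult_right_zero)
  qed
  moreover have "(\<lambda>x. \<integral>u. zonal_kernel n x u *\<^sub>R h u \<partial>\<sigma>) \<in> O_S2"
    by (rule Suc.IH[OF Suc.prems])
  moreover have "(\<lambda>x. \<integral>u. zonal_kernel n x u *\<^sub>R ?h i u \<partial>\<sigma>) \<in> O_S2" for i
    by (rule Suc.IH[OF h B])
  ultimately show ?case
    by (simp only:) (intro O_S2.add O_S2_sum O_S2.mult O_S2.coord)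
qed

definition mass :: "nat \<Rightarrow> real^3 \<Rightarrow> real" where
  "mass n x = (\<integral>u. zonal_kernel n x u \<partial>\<sigma>)"

text \<open>Up to division by \<open>mass\<close>, the mean distance from \<open>x\<close> under the kernel.\<close>

definition spread :: "nat \<Rightarrow> real^3 \<Rightarrow> real" where
  "spread n x = (\<integral>u. zonal_kernel n x u * d_S2 x u \<partial>\<sigma>)"

text \<open>
  Outside \<open>[-1, 1]\<close> the value of \<open>arccos\<close> is an unspecified constant, the same for all arguments,
  because there the description defining it is satisfied by nothing.
\<close>

lemma borel_measurable_arccos: "arccos \<in> borel_measurable borel"
proof -
  have "(\<lambda>y. arccos (max (- 1) (min 1 y))) \<in> borel_measurable borel"
    by (intro borel_measurable_continuous_onI continuous_intros) auto
  then have "(\<lambda>y. if - 1 \<le> y \<and> y \<le> 1 then arccos (max (- 1) (min 1 y)) else (THE x::real. False))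
      \<in> borel_measurable borel"
    by measurable
  also have "(\<lambda>y. if - 1 \<le> y \<and> y \<le> 1 then arccos (max (- 1) (min 1 y)) else (THE x::real. False)) = arccos"
  proof
    fix y :: real
    have "(THE x::real. False) = arccos y" if "\<not> (- 1 \<le> y \<and> y \<le> 1)"
      unfolding arccos_def using that cos_ge_minus_one cos_le_one
      by (intro arg_cong[where f = The]) auto
    then show "(if - 1 \<le> y \<and> y \<le> 1 then arccos (max (- 1) (min 1 y)) else (THE x::real. False)) = arccos y"
      by auto
  qed
  finally show ?thesis .
qed

lemma d_S2_measurable [measurable]: "d_S2 x \<in> borel_measurable borel"
proof -
  have "(\<lambda>y. x \<bullet> y) \<in> borel_measurable borel" by measurable
  then show ?thesis
    unfolding d_S2_def[abs_def] by (rule measurable_compose[OF _ borel_measurable_arccos])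
qed

lemma integrable_kernel_real: "integrable \<sigma> (zonal_kernel n x)"
  using integrable_kernel[of "\<lambda>_. 1 :: real" 1] by simp

lemma integrable_kernel_d_S2: "x \<in> S2 \<Longrightarrow> integrable \<sigma> (\<lambda>u. zonal_kernel n x u * d_S2 x u)"
  using integrable_kernel[of "d_S2 x" pi n x] d_S2_bounds[of x] by auto

text \<open>
  Both integrals are unchanged when \<open>x\<close> is rotated, and rotations act transitively. This makes
  the estimates at a single point uniform over the sphere.
\<close>

lemma mass_spread_constant:
  assumes "x \<in> S2" "x' \<in> S2"
  shows "mass n x' = mass n x" "spread n x' = spread n x"
proof -
  obtain R where R: "orthogonal_transformation R" "R x = x'"
    using rotation_between_unit_vectors[of x x'] assms by auto
  show "mass n x' = mass n x"
    using integral_kernel_rotation[OF R(1), of "\<lambda>_. 1 :: real" n x] by (simp add: mass_def R(2))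
  have "d_S2 x' (R u) = d_S2 x u" for u
    using R by (auto simp: d_S2_def orthogonal_transformation_def)
  then show "spread n x' = spread n x"
    using integral_kernel_rotation[OF R(1), of "d_S2 x'" n x] by (simp add: spread_def R(2))
qed

lemma mass_lower_bound:
  assumes x: "x \<in> S2" and t: "- 1 \<le> t"
  shows "(1 + t) ^ n * measure \<sigma> {u. t \<le> x \<bullet> u} \<le> mass n x"
proof -
  have C: "{u. t \<le> x \<bullet> u} \<in> sets borel" by measurable
  have "(1 + t) ^ n * measure \<sigma> {u. t \<le> x \<bullet> u} = (\<integral>u. (1 + t) ^ n * indicator {u. t \<le> x \<bullet> u} u \<partial>\<sigma>)"
    using C by simp
  also have "\<dots> \<le> mass n x"
    unfolding mass_def
  proof (rule integral_mono_AE)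
    show "integrable \<sigma> (\<lambda>u. (1 + t) ^ n * indicator {u. t \<le> x \<bullet> u} u)"
      using C by (intro integrable_mult_right integrable_real_indicator) (simp_all add: \<sigma>.emeasure_finite less_top[symmetric])
    show "AE u in \<sigma>. (1 + t) ^ n * indicator {u. t \<le> x \<bullet> u} u \<le> zonal_kernel n x u"
      using AE_\<sigma>_S2
    proof eventually_elim
      case (elim u)
      then show ?case
        using kernel_nonneg[OF x elim, of n] t
        by (auto simp: zonal_kernel_def indicator_def intro: power_mono)
    qed
  qed (rule integrable_kernel_real)
  finally show ?thesis .
qed

text \<open>
  Points within \<open>\<delta>\<close> of \<open>x\<close> contribute at most the first term. At the other points the kernel
  is at most \<open>(1 + cos \<delta>) ^ n\<close> and the distance at most \<open>\<pi>\<close>.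
\<close>

lemma spread_upper_bound:
  assumes x: "x \<in> S2" and \<delta>: "0 < \<delta>" "\<delta> \<le> pi"
  shows "spread n x \<le> \<delta> * mass n x + pi * (1 + cos \<delta>) ^ n * measure \<sigma> UNIV"
proof -
  have "spread n x \<le> (\<integral>u. \<delta> * zonal_kernel n x u + pi * (1 + cos \<delta>) ^ n \<partial>\<sigma>)"
    unfolding spread_def
  proof (rule integral_mono_AE)
    show "AE u in \<sigma>. zonal_kernel n x u * d_S2 x u \<le> \<delta> * zonal_kernel n x u + pi * (1 + cos \<delta>) ^ n"
      using AE_\<sigma>_S2
    proof eventually_elim
      case (elim u)
      note k = kernel_nonneg[OF x elim, of n] and d = d_S2_bounds[OF x elim]
      have "0 \<le> 1 + cos \<delta>" using cos_ge_minus_one[of \<delta>] by linarith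
      show ?case
      proof (cases "d_S2 x u \<le> \<delta>")
        case True
        then have "zonal_kernel n x u * d_S2 x u \<le> zonal_kernel n x u * \<delta>"
          using k by (intro mult_left_mono)
        moreover have "0 \<le> pi * (1 + cos \<delta>) ^ n"
          using \<open>0 \<le> 1 + cos \<delta>\<close> by simp
        ultimately show ?thesis by (simp add: mult.commute)
      next
        case False
        then have "cos (d_S2 x u) \<le> cos \<delta>"
          using \<delta> d by (intro cos_monotone_0_pi_le) auto
        then have "x \<bullet> u \<le> cos \<delta>"
          using inner_S2_bounds[OF x elim] by (simp add: d_S2_def)
        then have "zonal_kernel n x u \<le> (1 + cos \<delta>) ^ n"
          using inner_S2_bounds[OF x elim] by (auto simp: zonal_kernel_def intro: power_mono)
        then have "zonal_kernel n x u * d_S2 x u \<le> (1 + cos \<delta>) ^ n * pi"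
          using k d by (intro mult_mono) auto
        then show ?thesis using k \<delta> by (simp add: mult.commute add_increasing)
      qed
    qed
  qed (use x in \<open>auto intro!: integrable_kernel_d_S2 integrable_kernel_real Bochner_Integration.integrable_add\<close>)
  also have "\<dots> = \<delta> * mass n x + pi * (1 + cos \<delta>) ^ n * measure \<sigma> UNIV"
    by (subst Bochner_Integration.integral_add) (auto simp: mass_def integrable_kernel_real)
  finally show ?thesis .
qed

lemma mass_pos: "x \<in> S2 \<Longrightarrow> 0 < mass n x"
  using mass_lower_bound[of x 0 n] measure_\<sigma>_cap_pos[of x 0] by simp

text \<open>
  Beyond distance \<open>\<delta>\<close> the kernel is at most \<open>(1 + cos \<delta>) ^ n\<close>, while on the cap of radius \<open>\<delta> / 2\<close>,
  which has positive measure, it is at least \<open>(1 + cos (\<delta> / 2)) ^ n\<close>. The ratio of the two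
  decays geometrically, so for large \<open>n\<close> the far points are negligible against the total mass.
\<close>

lemma kernel_concentrates:
  assumes \<epsilon>: "0 < \<epsilon>"
  obtains n where "\<And>x. x \<in> S2 \<Longrightarrow> spread n x \<le> \<epsilon> * mass n x"
proof -
  define e :: "real^3" where "e = axis 1 1"
  have e: "e \<in> S2" by (simp add: e_def norm_axis_1)
  define \<delta> where "\<delta> = min (\<epsilon> / 2) 1"
  have \<delta>: "0 < \<delta>" "\<delta> \<le> 1" "\<delta> \<le> \<epsilon> / 2" using \<epsilon> by (auto simp: \<delta>_def)
  have pi: "3 < pi" by (rule pi_gt3)
  define a where "a = 1 + cos \<delta>"
  define b where "b = 1 + cos (\<delta> / 2)"
  define m where "m = measure \<sigma> {u. cos (\<delta> / 2) \<le> e \<bullet> u}"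
  have "cos \<delta> < cos (\<delta> / 2)" "cos (\<delta> / 2) < cos 0"
    using \<delta> pi by (intro cos_monotone_0_pi; simp)+
  then have ab: "0 \<le> a" "a < b" and m: "0 < m"
    using add_left_mono[OF cos_ge_minus_one[of \<delta>], of 1] measure_\<sigma>_cap_pos[OF e, of "cos (\<delta> / 2)"]
    by (simp_all add: a_def b_def m_def)
  have "(\<lambda>n. pi * measure \<sigma> UNIV * (a / b) ^ n) \<longlonglongrightarrow> pi * measure \<sigma> UNIV * 0"
    using ab by (intro tendsto_mult tendsto_const LIMSEQ_power_zero) auto
  then have "\<forall>\<^sub>F n in sequentially. pi * measure \<sigma> UNIV * (a / b) ^ n < \<epsilon> / 2 * m"
    using m \<epsilon> by (intro order_tendstoD(2)[where y = 0]) auto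
  then obtain n where n: "pi * measure \<sigma> UNIV * (a / b) ^ n < \<epsilon> / 2 * m"
    by (auto simp: eventually_sequentially)
  have "pi * a ^ n * measure \<sigma> UNIV = (pi * measure \<sigma> UNIV * (a / b) ^ n) * b ^ n"
    using ab by (simp add: power_divide)
  also have "\<dots> \<le> (\<epsilon> / 2 * m) * b ^ n"
    using n ab by (intro mult_right_mono) auto
  also have "\<dots> = \<epsilon> / 2 * (b ^ n * m)"
    by simp
  also have "\<dots> \<le> \<epsilon> / 2 * mass n e"
    using mass_lower_bound[OF e, of "cos (\<delta> / 2)" n] \<epsilon>
    by (intro mult_left_mono) (auto simp: b_def m_def)
  finally have far: "pi * a ^ n * measure \<sigma> UNIV \<le> \<epsilon> / 2 * mass n e" .
  have "\<delta> * mass n e \<le> \<epsilon> / 2 * mass n e"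
    using \<delta> mass_pos[OF e, of n] by (intro mult_right_mono) auto
  with far have "spread n e \<le> \<epsilon> * mass n e"
    using spread_upper_bound[OF e \<delta>(1), of n] \<delta> pi by (simp add: a_def)
  then show ?thesis
    using mass_spread_constant[OF e] by (intro that[of n]) simp
qed

section \<open>Convolution with the kernel\<close>

lemma norm_average_le:
  fixes h :: "real^3 \<Rightarrow> complex"
  assumes x: "x \<in> S2"
    and h: "h \<in> borel_measurable borel" "\<And>u. u \<in> S2 \<Longrightarrow> cmod (h u) \<le> B"
    and g: "integrable \<sigma> (\<lambda>u. zonal_kernel n x u * g u)" "\<And>u. u \<in> S2 \<Longrightarrow> cmod (h u) \<le> g u"
  shows "cmod (\<integral>u. zonal_kernel n x u *\<^sub>R h u \<partial>\<sigma>) \<le> (\<integral>u. zonal_kernel n x u * g u \<partial>\<sigma>)"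
proof -
  have "cmod (\<integral>u. zonal_kernel n x u *\<^sub>R h u \<partial>\<sigma>) \<le> (\<integral>u. cmod (zonal_kernel n x u *\<^sub>R h u) \<partial>\<sigma>)"
    by (rule integral_norm_bound)
  also have "\<dots> \<le> (\<integral>u. zonal_kernel n x u * g u \<partial>\<sigma>)"
  proof (rule integral_mono_AE)
    show "integrable \<sigma> (\<lambda>u. cmod (zonal_kernel n x u *\<^sub>R h u))"
      by (intro integrable_norm integrable_kernel[OF h])
    show "AE u in \<sigma>. cmod (zonal_kernel n x u *\<^sub>R h u) \<le> zonal_kernel n x u * g u"
      using AE_\<sigma>_S2
    proof eventually_elim
      case (elim u)
      then show ?case
        using kernel_nonneg[OF x elim, of n] g(2)[OF elim] by (simp add: mult_left_mono)
    qed
  qed (rule g)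
  finally show ?thesis .
qed

theorem corollaryC:
  fixes f :: "real^3 \<Rightarrow> complex" and \<epsilon> :: real
  assumes "lipschitz_S2 f" and "\<epsilon> > 0"
  shows "\<exists>p\<in>O_S2. Lip_S2 p \<le> Lip_S2 f
    \<and> supnorm_S2 (\<lambda>x. f x - p x) \<le> ennreal \<epsilon> * Lip_S2 f"
proof -
  obtain L where L: "0 \<le> L" "Lip_S2 f = ennreal L"
    and lip: "\<And>x y. x \<in> S2 \<Longrightarrow> y \<in> S2 \<Longrightarrow> cmod (f x - f y) \<le> L * d_S2 x y"
    using lipschitz_S2_attains_Lip[OF assms(1)] by blast
  obtain n where conc: "\<And>x. x \<in> S2 \<Longrightarrow> spread n x \<le> \<epsilon> * mass n x"
    using kernel_concentrates[OF assms(2)] by blast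
  \<comment> \<open>\<open>f\<close> is arbitrary off the sphere, so it is cut off there to become Borel measurable.\<close>
  define h where "h u = indicator S2 u *\<^sub>R f u" for u
  have hf: "h u = f u" if "u \<in> S2" for u
    using that by (simp add: h_def)
  have cont: "continuous_on S2 f"
    by (rule lipschitz_S2_imp_continuous[OF lip])
  have h [measurable]: "h \<in> borel_measurable borel"
    unfolding h_def by (rule borel_measurable_continuous_on_indicator[OF _ cont]) simp
  have "bounded (f ` S2)"
    by (intro compact_imp_bounded compact_continuous_image cont) simp
  then obtain B where "\<forall>y\<in>f ` S2. norm y \<le> B"
    by (auto simp: bounded_iff)
  then have B: "cmod (h u) \<le> B" if "u \<in> S2" for u
    using that hf by auto
  define e :: "real^3" where "e = axis 1 1"
  have e: "e \<in> S2" by (simp add: e_def norm_axis_1)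
  define c where "c = mass n e"
  have c: "0 < c" and mass: "\<And>x. x \<in> S2 \<Longrightarrow> mass n x = c"
    using mass_pos[OF e] mass_spread_constant(1)[OF e] by (simp_all add: c_def)
  define P where "P x = (\<integral>u. zonal_kernel n x u *\<^sub>R h u \<partial>\<sigma>)" for x
  define p where "p x = complex_of_real (1 / c) * P x" for x
  have "P \<in> O_S2"
    unfolding P_def[abs_def] by (rule integral_kernel_in_O_S2[OF h B])
  then have "p \<in> O_S2"
    unfolding p_def[abs_def] by (intro O_S2.mult O_S2.const)
  \<comment> \<open>Used with \<open>y = p x\<close> for the Lipschitz bound and with \<open>y = f x\<close> for the uniform one.\<close>
  have p_diff: "cmod (p x - y) \<le> C" if "cmod (P x - c *\<^sub>R y) \<le> C * c" for x y C
  proof -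
    have "p x - y = (1 / c) *\<^sub>R (P x - c *\<^sub>R y)"
      using c by (simp add: p_def scaleR_conv_of_real field_simps)
    then have "cmod (p x - y) = cmod (P x - c *\<^sub>R y) / c"
      using c by simp
    then show ?thesis
      using that c by (simp add: divide_le_eq)
  qed
  have "Lip_S2 p \<le> ennreal L"
  proof (rule Lip_S2_le)
    fix x' x :: "real^3"
    assume x: "x' \<in> S2" "x \<in> S2"
    obtain R where R: "orthogonal_transformation R" "R x = x'"
      "\<And>y. norm y = 1 \<Longrightarrow> x \<bullet> x' \<le> y \<bullet> R y"
      using rotation_between_unit_vectors[of x x'] x by auto
    have RS: "R u \<in> S2" if "u \<in> S2" for u
      using R(1) that by (simp add: orthogonal_transformation_norm)
    have [measurable]: "R \<in> borel_measurable borel"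
      by (rule orthogonal_transformation_measurable[OF R(1)])
    have hR: "(\<lambda>u. h (R u)) \<in> borel_measurable borel" by measurable
    have move: "cmod (h (R u) - h u) \<le> L * d_S2 x' x" if u: "u \<in> S2" for u
    proof -
      have "d_S2 (R u) u \<le> d_S2 x' x"
        unfolding d_S2_def using R(3)[of u] u inner_S2_bounds[OF x] inner_S2_bounds[OF RS[OF u] u]
        by (intro arccos_le_arccos) (auto simp: inner_commute)
      then show ?thesis
        using lip[OF RS[OF u] u] L(1) hf RS[OF u] u
        by (simp) (meson mult_left_mono order_trans)
    qed
    have "P x' - P x = (\<integral>u. zonal_kernel n x u *\<^sub>R h (R u) \<partial>\<sigma>) - (\<integral>u. zonal_kernel n x u *\<^sub>R h u \<partial>\<sigma>)"
      using integral_kernel_rotation[OF R(1) h, of n x] by (simp add: P_def R(2))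
    also have "\<dots> = (\<integral>u. zonal_kernel n x u *\<^sub>R (h (R u) - h u) \<partial>\<sigma>)"
      using integrable_kernel[OF hR, of B n x] integrable_kernel[OF h B, of n x] B RS
      by (simp add: scaleR_diff_right Bochner_Integration.integral_diff)
    also have "cmod \<dots> \<le> (\<integral>u. zonal_kernel n x u * (L * d_S2 x' x) \<partial>\<sigma>)"
      by (rule norm_average_le[OF x(2) _ move _ move])
        (auto intro: integrable_kernel_real)
    also have "\<dots> = L * d_S2 x' x * c"
      using mass[OF x(2)] by (simp add: mass_def)
    finally have "cmod (P x' - c *\<^sub>R p x) \<le> L * d_S2 x' x * c"
      using c by (simp add: p_def scaleR_conv_of_real)
    then show "cmod (p x' - p x) \<le> L * d_S2 x' x"
      by (rule p_diff)
  qed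
  moreover have approx: "cmod (f x - p x) \<le> \<epsilon> * L" if x: "x \<in> S2" for x
  proof -
    have hfx: "cmod (h u - f x) \<le> L * d_S2 x u" if u: "u \<in> S2" for u
      using lip[OF x u] hf[OF u] by (simp add: norm_minus_commute)
    have "P x - c *\<^sub>R f x = (\<integral>u. zonal_kernel n x u *\<^sub>R h u \<partial>\<sigma>) - (\<integral>u. zonal_kernel n x u *\<^sub>R f x \<partial>\<sigma>)"
      using mass[OF x] integrable_kernel_real by (simp add: P_def mass_def)
    also have "\<dots> = (\<integral>u. zonal_kernel n x u *\<^sub>R (h u - f x) \<partial>\<sigma>)"
      using integrable_kernel[of "\<lambda>_. f x" "cmod (f x)" n x] integrable_kernel[OF h B, of n x]
      by (simp add: scaleR_diff_right Bochner_Integration.integral_diff)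
    also have "cmod \<dots> \<le> (\<integral>u. zonal_kernel n x u * (L * d_S2 x u) \<partial>\<sigma>)"
    proof (rule norm_average_le[OF x _ _ _ hfx])
      show "cmod (h u - f x) \<le> B + cmod (f x)" if "u \<in> S2" for u
        using B[OF that] norm_triangle_ineq4[of "h u" "f x"] by linarith
      show "integrable \<sigma> (\<lambda>u. zonal_kernel n x u * (L * d_S2 x u))"
        using integrable_mult_right[OF integrable_kernel_d_S2[OF x, of n], of L] by (simp add: ac_simps)
    qed simp_all
    also have "\<dots> = L * spread n x"
      by (simp add: spread_def mult.left_commute)
    also have "\<dots> \<le> L * (\<epsilon> * c)"
      using conc[OF x] mass[OF x] L(1) by (intro mult_left_mono) auto
    finally have "cmod (P x - c *\<^sub>R f x) \<le> \<epsilon> * L * c"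
      by (simp add: ac_simps)
    then have "cmod (p x - f x) \<le> \<epsilon> * L"
      by (rule p_diff)
    then show ?thesis by (simp add: norm_minus_commute)
  qed
  then have "supnorm_S2 (\<lambda>x. f x - p x) \<le> ennreal (\<epsilon> * L)"
    unfolding supnorm_S2_def by (intro SUP_least ennreal_leI) auto
  ultimately show ?thesis
    using \<open>p \<in> O_S2\<close> L assms(2) by (intro bexI[of _ p]) (simp_all add: ennreal_mult)
qed

end
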